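(* There exist constants $\eta>0$ and $q\in\mathbb{N}$ such that, with probability tending to $1$ as $n\to\infty$, every perfect induced subgraph of $G(n,1/2)$ is contained in one of at most $n^q$ vertex sets of size at most $(1-\eta)n$.
   Context: $G(n,1/2)$ is the binomial random graph on $n$ vertices with edge probability $1/2$. A graph is perfect if every induced subgraph has chromatic number equal to its clique number. "A perfect induced subgraph is contained in a vertex set" means that its vertex set is a subset of that set. The family of at most $n^q$ vertex sets may depend on the realization of $G(n,1/2)$. *)

theory Defs
  imports "HOL-Probability.Probability" "HOL-Probability.Product_PMF"
begin

text \<open>A graph is a pair of a vertex set and an edge set, where an edge is the
  two-element set of its end points.\<close>

type_synonym 'a graph = "'a set \<times> 'a set set"

abbreviation verts :: "'a graph \<Rightarrow> 'a set" where
  "verts G \<equiv> fst G"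

abbreviation edges :: "'a graph \<Rightarrow> 'a set set" where
  "edges G \<equiv> snd G"

definition all_edges :: "'a set \<Rightarrow> 'a set set" where
  "all_edges V = {e. e \<subseteq> V \<and> card e = 2}"

definition induced_subgraph :: "'a graph \<Rightarrow> 'a set \<Rightarrow> 'a graph" where
  "induced_subgraph G W = (W, {e \<in> edges G. e \<subseteq> W})"

definition is_clique :: "'a graph \<Rightarrow> 'a set \<Rightarrow> bool" where
  "is_clique G C \<longleftrightarrow> C \<subseteq> verts G \<and> (\<forall>u\<in>C. \<forall>v\<in>C. u \<noteq> v \<longrightarrow> {u, v} \<in> edges G)"

text \<open>The next two numbers are meant for finite graphs; both are 0 for the graph
  without vertices.\<close>

definition clique_number :: "'a graph \<Rightarrow> nat" where
  "clique_number G = Max {card C | C. is_clique G C}"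

definition proper_colouring :: "'a graph \<Rightarrow> nat \<Rightarrow> ('a \<Rightarrow> nat) \<Rightarrow> bool" where
  "proper_colouring G k c \<longleftrightarrow>
     (\<forall>v\<in>verts G. c v < k) \<and>
     (\<forall>u\<in>verts G. \<forall>v\<in>verts G. {u, v} \<in> edges G \<longrightarrow> c u \<noteq> c v)"

definition chromatic_number :: "'a graph \<Rightarrow> nat" where
  "chromatic_number G = (LEAST k. \<exists>c. proper_colouring G k c)"

definition perfect :: "'a graph \<Rightarrow> bool" where
  "perfect G \<longleftrightarrow>
     (\<forall>W\<subseteq>verts G. chromatic_number (induced_subgraph G W) = clique_number (induced_subgraph G W))"

definition random_graph :: "nat \<Rightarrow> real \<Rightarrow> nat graph pmf" where
  "random_graph n p =
     map_pmf (\<lambda>f. ({..<n}, {e \<in> all_edges {..<n}. f e}))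
       (Pi_pmf (all_edges {..<n}) False (\<lambda>_. bernoulli_pmf p))"

end

theory Submission
  imports Defs "HOL-Probability.Hoeffding" "HOL-Real_Asymp.Real_Asymp"
begin

text \<open>
  A perfect graph contains no induced 5-cycle, and an induced 5-cycle can be built one vertex at
  a time: start with a vertex, extend it to an induced path on two, three and four vertices,
  and close the path. Each step asks for a vertex that is adjacent to all of a set \<open>A\<close> and to
  none of a set \<open>B\<close>, where \<open>A\<close> and \<open>B\<close> consist of vertices chosen before and have at most two
  elements. If \<open>W\<close> induces a perfect subgraph, this greedy construction cannot be completed
  inside \<open>W\<close>. Hence there are disjoint \<open>A, B \<subseteq> W\<close> with at most two elements each such that \<open>W\<close>
  misses all the vertices joined to \<open>A\<close> and not to \<open>B\<close> (\<open>perfect_misses_witnesses\<close>).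
  The containers are therefore the complements of these vertex sets: there are at most
  \<open>(n\<^sup>2 + 1)\<^sup>2 \<le> n\<^sup>6\<close> of them for \<open>n \<ge> 2\<close>, since a container is determined by \<open>(A, B)\<close>.

  It remains to see that every container omits a constant proportion of the vertices. For fixed
  \<open>(A, B)\<close>, a vertex outside \<open>A \<union> B\<close> has the required adjacencies with probability at least
  \<open>1/16\<close>, independently of the other vertices, because distinct vertices look at disjoint sets
  of edges. By Hoeffding's inequality fewer than half of the expected number occur only with
  probability exponentially small in \<open>n\<close> (\<open>prob_few_witnesses\<close>), which survives the union bound
  over polynomially many pairs.
\<close>

section \<open>Induced five-cycles and perfect graphs\<close>

text \<open>
  The vertices omitted by the container that belongs to \<open>(A, B)\<close>. Excluding \<open>A \<union> B\<close> itself
  makes the vertices of the greedy construction distinct; moreover, \<open>witnesses G {} {}\<close> is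
  the whole vertex set, so that the container of \<open>({}, {})\<close> is empty and takes care of \<open>W = {}\<close>.
\<close>

definition witnesses :: "'a graph \<Rightarrow> 'a set \<Rightarrow> 'a set \<Rightarrow> 'a set" where
  "witnesses G A B = {v \<in> verts G - (A \<union> B).
     (\<forall>w\<in>A. {v, w} \<in> edges G) \<and> (\<forall>w\<in>B. {v, w} \<notin> edges G)}"

lemma induced_subgraph_twice:
  "U \<subseteq> W \<Longrightarrow> induced_subgraph (induced_subgraph G W) U = induced_subgraph G U"
  by (auto simp: induced_subgraph_def)

text \<open>
  The chromatic number is a least element and means nothing unless some colouring exists; loops
  would rule out every colouring.
\<close>

lemma ex_proper_colouring:
  assumes "finite (verts G)" "\<And>v. {v} \<notin> edges G"
  shows "\<exists>k c. proper_colouring G k c"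
proof -
  obtain c :: "'a \<Rightarrow> nat" where c: "bij_betw c (verts G) {..<card (verts G)}"
    using ex_bij_betw_finite_nat[OF assms(1)] by (auto simp: atLeast0LessThan)
  have "c v < card (verts G)" if "v \<in> verts G" for v
    using c that by (auto simp: bij_betw_def)
  moreover have "u = v" if "u \<in> verts G" "v \<in> verts G" "c u = c v" for u v
    using c that by (auto simp: bij_betw_def inj_on_def)
  ultimately have "proper_colouring G (card (verts G)) c"
    using assms(2) unfolding proper_colouring_def by fastforce
  then show ?thesis by blast
qed

text \<open>
  The 5-cycle has no triangle, so perfection would give it a proper colouring with two colours,
  which an odd cycle does not have.
\<close>

lemma five_hole_not_perfect:
  assumes distinct: "distinct [a, b, c, d, e]"
    and loops: "\<And>v. {v} \<notin> edges G"
    and cycle: "{a, b} \<in> edges G" "{b, c} \<in> edges G" "{c, d} \<in> edges G"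
      "{d, e} \<in> edges G" "{e, a} \<in> edges G"
    and chords: "{a, c} \<notin> edges G" "{b, d} \<notin> edges G" "{c, e} \<notin> edges G"
      "{d, a} \<notin> edges G" "{e, b} \<notin> edges G"
    and W: "{a, b, c, d, e} \<subseteq> W"
  shows "\<not> perfect (induced_subgraph G W)"
proof
  assume perf: "perfect (induced_subgraph G W)"
  define U where "U = {a, b, c, d, e}"
  define H where "H = induced_subgraph G U"
  have V: "verts H = U" by (simp add: H_def induced_subgraph_def)
  have E: "{x, y} \<in> edges H \<longleftrightarrow> x \<in> U \<and> y \<in> U \<and> {x, y} \<in> edges G" for x y
    by (auto simp: H_def induced_subgraph_def)
  have "U \<subseteq> verts (induced_subgraph G W)" using W by (simp add: U_def induced_subgraph_def)
  moreover have "induced_subgraph (induced_subgraph G W) U = H"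
    unfolding H_def by (rule induced_subgraph_twice) (use W in \<open>simp add: U_def\<close>)
  ultimately have eq: "chromatic_number H = clique_number H"
    using perf unfolding perfect_def by metis
  have le2: "card C \<le> 2" if C: "is_clique H C" for C
  proof (rule ccontr)
    assume "\<not> card C \<le> 2"
    then obtain T where T: "T \<subseteq> C" "card T = 3"
      by (metis obtain_subset_with_card_n not_less_eq_eq numeral_2_eq_2 numeral_3_eq_3)
    then obtain x y z where xyz: "T = {x, y, z}" "x \<noteq> y" "x \<noteq> z" "y \<noteq> z"
      by (auto simp: card_3_iff)
    have U3: "x \<in> U" "y \<in> U" "z \<in> U"
      using C T xyz unfolding is_clique_def V by auto
    have "{x, y} \<in> edges G" "{x, z} \<in> edges G" "{y, z} \<in> edges G"
      using C T xyz unfolding is_clique_def E by blast+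
    with U3 xyz(2-4) chords show False
      unfolding U_def by (auto simp: insert_commute)
  qed
  have clq2: "clique_number H \<le> 2"
  proof -
    have "{card C | C. is_clique H C} \<subseteq> {..2}" using le2 by auto
    moreover have "is_clique H {}" by (simp add: is_clique_def)
    ultimately show ?thesis
      unfolding clique_number_def
      by (subst Max_le_iff) (auto intro: finite_subset le2)
  qed
  have "\<exists>k c. proper_colouring H k c"
  proof (rule ex_proper_colouring)
    show "finite (verts H)" by (simp add: V U_def)
    show "\<And>v. {v} \<notin> edges H" using loops by (auto simp: H_def induced_subgraph_def)
  qed
  then have "\<exists>c. proper_colouring H (chromatic_number H) c"
    unfolding chromatic_number_def by (rule LeastI_ex)
  then obtain col where col: "proper_colouring H (chromatic_number H) col" by blast
  with eq clq2 have lt: "\<forall>v\<in>U. col v < 2"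
    unfolding proper_colouring_def V by (metis order_less_le_trans)
  have "col a \<noteq> col b" "col b \<noteq> col c" "col c \<noteq> col d" "col d \<noteq> col e" "col e \<noteq> col a"
    using col cycle unfolding proper_colouring_def V E by (auto simp: U_def)
  with lt show False unfolding U_def by simp
qed

text \<open>
  This is the greedy construction: if \<open>W\<close> contained a witness for every such pair, then witnesses
  chosen in turn would form an induced path \<open>a b c d\<close> together with a vertex \<open>e\<close> closing
  it to an induced 5-cycle in \<open>W\<close>.
\<close>

lemma perfect_misses_witnesses:
  assumes loops: "\<And>v. {v} \<notin> edges G"
    and perf: "perfect (induced_subgraph G W)"
  obtains A B where "A \<subseteq> W" "B \<subseteq> W" "A \<inter> B = {}" "card A \<le> 2" "card B \<le> 2"
    "W \<inter> witnesses G A B = {}"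
proof -
  have False if meets:
    "\<And>A B. A \<subseteq> W \<Longrightarrow> B \<subseteq> W \<Longrightarrow> A \<inter> B = {} \<Longrightarrow> card A \<le> 2 \<Longrightarrow> card B \<le> 2 \<Longrightarrow>
       \<exists>v. v \<in> W \<and> v \<in> witnesses G A B"
  proof -
    obtain a where a: "a \<in> W" using meets[of "{}" "{}"] by auto
    obtain b where b: "b \<in> W" "b \<in> witnesses G {a} {}" using meets[of "{a}" "{}"] a by auto
    then have b': "b \<noteq> a" "{b, a} \<in> edges G" by (auto simp: witnesses_def)
    obtain c where c: "c \<in> W" "c \<in> witnesses G {b} {a}" using meets[of "{b}" "{a}"] a b b' by auto
    then have c': "c \<noteq> a" "c \<noteq> b" "{c, b} \<in> edges G" "{c, a} \<notin> edges G"
      by (auto simp: witnesses_def)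
    obtain d where d: "d \<in> W" "d \<in> witnesses G {c} {a, b}"
      using meets[of "{c}" "{a, b}"] a b c b' c' by auto
    then have d': "d \<noteq> a" "d \<noteq> b" "d \<noteq> c" "{d, c} \<in> edges G" "{d, a} \<notin> edges G" "{d, b} \<notin> edges G"
      by (auto simp: witnesses_def)
    obtain e where e: "e \<in> W" "e \<in> witnesses G {a, d} {b, c}"
      using meets[of "{a, d}" "{b, c}"] a b c d b' c' d' by auto
    then have e': "e \<noteq> a" "e \<noteq> b" "e \<noteq> c" "e \<noteq> d" "{e, a} \<in> edges G" "{e, d} \<in> edges G"
      "{e, b} \<notin> edges G" "{e, c} \<notin> edges G"
      by (auto simp: witnesses_def)
    have "\<not> perfect (induced_subgraph G W)"
      by (rule five_hole_not_perfect[of a b c d e])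
        (use loops a b b' c c' d d' e e' in \<open>auto simp: insert_commute\<close>)
    with perf show False by simp
  qed
  with that show ?thesis by blast
qed

section \<open>Concentration\<close>

text \<open>
  Each block of at most \<open>k\<close> fair coins shows the prescribed pattern \<open>t\<close> with probability at least
  \<open>1 / 2 ^ k\<close>, and disjoint blocks are independent. So the number of matching
  blocks has mean at least \<open>card L / 2 ^ k\<close>, and Hoeffding's inequality bounds the probability
  that it is at most half of that.
\<close>

lemma prob_few_matching_blocks:
  fixes K :: "'v \<Rightarrow> 'e set"
  assumes E: "finite E" and L: "finite L"
    and K: "\<And>v. v \<in> L \<Longrightarrow> K v \<subseteq> E" "\<And>v. v \<in> L \<Longrightarrow> card (K v) \<le> k"
    and disj: "disjoint_family_on K L"
  shows "measure_pmf.prob (Pi_pmf E d (\<lambda>_. bernoulli_pmf (1/2)))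
      {f. real (card {v \<in> L. \<forall>e\<in>K v. f e = t e}) \<le> real (card L) / 2 ^ (k + 1)}
    \<le> exp (- real (card L) / 2 ^ (2 * k + 1))"
proof (cases "L = {}")
  case True
  then show ?thesis by simp
next
  case False
  define M where "M = Pi_pmf E d (\<lambda>_. bernoulli_pmf (1/2))"
  define X where "X = (\<lambda>v f. \<Prod>e\<in>K v. of_bool (f e = t e) :: real)"
  define m where "m = real (card L)"
  have m: "m > 0" using False L by (simp add: m_def card_gt_0_iff)
  have finK: "finite (K v)" if "v \<in> L" for v using K(1)[OF that] E by (rule finite_subset)
  have X_eq: "X v f = of_bool (\<forall>e\<in>K v. f e = t e)" if "v \<in> L" for v f
    using finK[OF that] by (auto simp: X_def prod_zero_iff)
  have "prob_space.indep_vars M (\<lambda>_. count_space UNIV) (\<lambda>x f. f x) E"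
    unfolding M_def by (rule indep_vars_Pi_pmf[OF E])
  from prob_space.indep_vars_restrict[OF measure_pmf.prob_space_axioms this K(1) disj]
  have "prob_space.indep_vars M (\<lambda>v. PiM (K v) (\<lambda>_. count_space UNIV))
      (\<lambda>v f. restrict f (K v)) L" by simp
  then have "prob_space.indep_vars M (\<lambda>_. borel) (\<lambda>v f. X v (restrict f (K v))) L"
    unfolding X_def
    by (rule prob_space.indep_vars_compose2[OF measure_pmf.prob_space_axioms]) measurable
  also have "(\<lambda>v f. X v (restrict f (K v))) = X"
    by (auto simp: X_def fun_eq_iff intro!: prod.cong)
  finally have indep: "prob_space.indep_vars M (\<lambda>_. borel) X L" .
  interpret Hoeffding_ineq M L X "\<lambda>_. 0" "\<lambda>_. 1" "\<Sum>v\<in>L. measure_pmf.expectation M (X v)"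
    by unfold_locales (auto simp: L indep X_eq)
  have EX: "measure_pmf.expectation M (X v) \<ge> 1 / 2 ^ k" if v: "v \<in> L" for v
  proof -
    \<comment> \<open>the match on the block as a product event on all of \<open>E\<close>, free outside the block\<close>
    define B where "B = (\<lambda>e. if e \<in> K v then {t e} else UNIV)"
    have "X v = indicator (Pi E B)"
      using K(1)[OF v] by (auto simp: X_eq[OF v] B_def fun_eq_iff indicator_def Pi_iff)
    then have "measure_pmf.expectation M (X v) = measure_pmf.prob M (Pi E B)"
      by simp
    also have "\<dots> = (\<Prod>e\<in>E. measure_pmf.prob (bernoulli_pmf (1/2)) (B e))"
      unfolding M_def by (rule measure_Pi_pmf_Pi[OF E])
    also have "\<dots> = (\<Prod>e\<in>E. if e \<in> K v then 1/2 else 1)"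
    proof (rule prod.cong)
      fix e
      have "pmf (bernoulli_pmf (1/2)) (t e) = 1/2" by (cases "t e") simp_all
      then show "measure_pmf.prob (bernoulli_pmf (1/2)) (B e) = (if e \<in> K v then 1/2 else 1)"
        by (simp add: B_def measure_pmf_single)
    qed simp
    also have "\<dots> = (1/2) ^ card (K v)"
      using K(1)[OF v] E by (simp add: prod.If_cases Int_absorb1)
    also have "\<dots> \<ge> (1/2) ^ k" using K(2)[OF v] by (intro power_decreasing) auto
    finally show ?thesis by (simp add: power_divide)
  qed
  have mean: "(\<Sum>v\<in>L. measure_pmf.expectation M (X v)) \<ge> m / 2 ^ k"
    using sum_mono[of L "\<lambda>_. 1 / 2 ^ k", OF EX] by (simp add: m_def)
  have "measure_pmf.prob M {f. real (card {v \<in> L. \<forall>e\<in>K v. f e = t e}) \<le> m / 2 ^ (k + 1)}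
    \<le> measure_pmf.prob M {f \<in> space M. (\<Sum>v\<in>L. X v f) \<le>
        (\<Sum>v\<in>L. measure_pmf.expectation M (X v)) - m / 2 ^ (k + 1)}"
  proof (intro measure_pmf.finite_measure_mono)
    have "(\<Sum>v\<in>L. X v f) = real (card {v \<in> L. \<forall>e\<in>K v. f e = t e})" for f
      using L by (simp add: X_eq Int_def)
    with mean show "{f. real (card {v \<in> L. \<forall>e\<in>K v. f e = t e}) \<le> m / 2 ^ (k + 1)} \<subseteq>
       {f \<in> space M. (\<Sum>v\<in>L. X v f) \<le>
        (\<Sum>v\<in>L. measure_pmf.expectation M (X v)) - m / 2 ^ (k + 1)}"
      by (auto simp: field_simps)
  qed auto
  also have "\<dots> \<le> exp (- 2 * (m / 2 ^ (k + 1))\<^sup>2 / (\<Sum>v\<in>L. (1 - 0)\<^sup>2))"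
    by (rule Hoeffding_ineq_le) (use m in \<open>auto simp: m_def\<close>)
  also have "- 2 * (m / 2 ^ (k + 1))\<^sup>2 / (\<Sum>v\<in>L. (1 - 0)\<^sup>2) = - m / 2 ^ (2 * k + 1)"
    using m by (simp add: m_def[symmetric] power2_eq_square power_mult field_simps)
  finally show ?thesis by (simp add: M_def m_def)
qed

text \<open>
  The blocks are the pairs that join a vertex outside \<open>A \<union> B\<close> to \<open>A \<union> B\<close>; those of
  different vertices are disjoint. Being a witness means that a pair of the block is
  an edge exactly if it meets \<open>A\<close>.
\<close>

lemma prob_few_witnesses:
  assumes AB: "A \<subseteq> {..<n}" "B \<subseteq> {..<n}" "A \<inter> B = {}" "card A + card B \<le> k"
  shows "measure_pmf.prob (random_graph n (1/2))
      {G. real (card (witnesses G A B)) \<le> (real n - real k) / 2 ^ (k + 1)}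
    \<le> exp (- (real n - real k) / 2 ^ (2 * k + 1))"
proof -
  define L where "L = {..<n} - (A \<union> B)"
  define K where "K = (\<lambda>v. (\<lambda>w. {v, w}) ` (A \<union> B))"
  define E where "E = all_edges {..<n}"
  have finAB: "finite A" "finite B" using AB finite_subset by blast+
  have "card (A \<union> B) \<le> k" using AB finAB by (simp add: card_Un_disjoint)
  have L: "finite L" "real (card L) \<ge> real n - real k"
    using AB finAB \<open>card (A \<union> B) \<le> k\<close> by (auto simp: L_def card_Diff_subset)
  have E: "finite E" unfolding E_def all_edges_def by simp
  have K: "K v \<subseteq> E" "card (K v) \<le> k" if "v \<in> L" for v
    using that AB \<open>card (A \<union> B) \<le> k\<close> card_image_le[of "A \<union> B" "\<lambda>w. {v, w}"] finAB
    by (auto simp: K_def L_def E_def all_edges_def card_insert_if)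
  have disj: "disjoint_family_on K L"
    by (auto simp: disjoint_family_on_def K_def L_def doubleton_eq_iff)
  have W: "witnesses ({..<n}, {e \<in> E. f e}) A B = {v \<in> L. \<forall>e\<in>K v. f e = (e \<inter> A \<noteq> {})}" for f
  proof -
    have "{v, w} \<in> E" if "v \<in> L" "w \<in> A \<union> B" for v w
      using K(1)[OF that(1)] that(2) by (auto simp: K_def)
    then show ?thesis using AB(3) by (auto simp: witnesses_def K_def L_def)
  qed
  have "measure_pmf.prob (random_graph n (1/2))
      {G. real (card (witnesses G A B)) \<le> (real n - real k) / 2 ^ (k + 1)}
    \<le> measure_pmf.prob (Pi_pmf E False (\<lambda>_. bernoulli_pmf (1/2)))
      {f. real (card {v \<in> L. \<forall>e\<in>K v. f e = (e \<inter> A \<noteq> {})}) \<le> real (card L) / 2 ^ (k + 1)}"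
    using L(2) unfolding random_graph_def E_def[symmetric] measure_map_pmf
    by (intro measure_pmf.finite_measure_mono) (auto simp: W field_simps)
  also have "\<dots> \<le> exp (- real (card L) / 2 ^ (2 * k + 1))"
    by (rule prob_few_matching_blocks[OF E L(1) K disj])
  also have "\<dots> \<le> exp (- (real n - real k) / 2 ^ (2 * k + 1))"
    using L(2) by (simp add: field_simps)
  finally show ?thesis .
qed

section \<open>The containers\<close>

definition small_pairs :: "'a set \<Rightarrow> ('a set \<times> 'a set) set" where
  "small_pairs V = {(A, B). A \<subseteq> V \<and> B \<subseteq> V \<and> A \<inter> B = {} \<and> card A \<le> 2 \<and> card B \<le> 2}"

lemma card_small_pairs:
  assumes V: "finite V"
  shows "finite (small_pairs V)" "card (small_pairs V) \<le> (card V ^ 2 + 1) ^ 2"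
proof -
  \<comment> \<open>a superset of the sets with at most two elements; singletons arise as \<open>{x, x}\<close>\<close>
  define P where "P = insert {} ((\<lambda>(x, y). {x, y}) ` (V \<times> V))"
  have P: "finite P" using V by (simp add: P_def)
  have "card ((\<lambda>(x, y). {x, y}) ` (V \<times> V)) \<le> card V ^ 2"
    using card_image_le[of "V \<times> V" "\<lambda>(x, y). {x, y}"] V
    by (simp add: card_cartesian_product power2_eq_square)
  then have cP: "card P \<le> card V ^ 2 + 1"
    using card_insert_le_m1[of "card V ^ 2 + 1"] by (simp add: P_def)
  have pair: "{x, y} \<in> P" if "x \<in> V" "y \<in> V" for x y
    using that by (force simp: P_def)
  have "A \<in> P" if A: "A \<subseteq> V" "card A \<le> 2" for A
  proof -
    have "finite A" using A V finite_subset by blast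
    consider "card A = 0" | "card A = 1" | "card A = 2" using A(2) by linarith
    then show ?thesis
    proof cases
      case 1
      with \<open>finite A\<close> show ?thesis by (simp add: P_def)
    next
      case 2
      then obtain x where "A = {x}" by (auto simp: card_1_singleton_iff)
      with A(1) pair[of x x] show ?thesis by simp
    next
      case 3
      then obtain x y where "A = {x, y}" by (auto simp: card_2_iff)
      with A(1) pair show ?thesis by simp
    qed
  qed
  then have sub: "small_pairs V \<subseteq> P \<times> P" by (auto simp: small_pairs_def)
  then show "finite (small_pairs V)" using P by (meson finite_SigmaI finite_subset)
  have "card (small_pairs V) \<le> card P * card P"
    using card_mono[OF _ sub] P by (simp add: card_cartesian_product)
  also have "\<dots> \<le> (card V ^ 2 + 1) ^ 2"
    using cP by (simp only: power2_eq_square mult_le_mono)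
  finally show "card (small_pairs V) \<le> (card V ^ 2 + 1) ^ 2" .
qed

text \<open>
  The witness bound \<open>(n - 4) / 2 ^ 5\<close> is half of the lower bound \<open>(n - 4) / 2 ^ 4\<close> on the
  expected number, as at least \<open>n - 4\<close> vertices lie outside \<open>A \<union> B\<close>; it is at least \<open>n / 64\<close> once \<open>n \<ge> 8\<close>.
\<close>

lemma small_container_family:
  fixes n :: nat
  assumes G: "verts G = {..<n}" "edges G \<subseteq> all_edges {..<n}" and n: "n \<ge> 8"
    and many: "\<And>A B. (A, B) \<in> small_pairs {..<n} \<Longrightarrow>
       real (card (witnesses G A B)) > (real n - 4) / 2 ^ 5"
  shows "\<exists>F :: nat set set. finite F \<and> card F \<le> n ^ 6 \<and>
           (\<forall>S\<in>F. S \<subseteq> verts G \<and> real (card S) \<le> (1 - 1/64) * real n) \<and>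
           (\<forall>W\<subseteq>verts G. perfect (induced_subgraph G W) \<longrightarrow> (\<exists>S\<in>F. W \<subseteq> S))"
proof (intro exI conjI)
  define F where "F = (\<lambda>(A, B). {..<n} - witnesses G A B) ` small_pairs {..<n}"
  show "finite F" by (simp add: F_def card_small_pairs)
  have "card F \<le> card (small_pairs {..<n})"
    unfolding F_def by (intro card_image_le card_small_pairs) simp
  also have "\<dots> \<le> (n ^ 2 + 1) ^ 2"
    using card_small_pairs(2)[of "{..<n}"] by simp
  also have "\<dots> \<le> (n ^ 3) ^ 2"
  proof (rule power_mono)
    have "n ^ 2 + 1 \<le> 2 * n ^ 2" using n by simp
    also have "\<dots> \<le> n * n ^ 2" using n by (intro mult_right_mono) auto
    finally show "n ^ 2 + 1 \<le> n ^ 3" by (simp add: power3_eq_cube power2_eq_square)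
  qed simp
  finally show "card F \<le> n ^ 6" by (simp flip: power_mult)
  show "\<forall>S\<in>F. S \<subseteq> verts G \<and> real (card S) \<le> (1 - 1/64) * real n"
  proof
    fix S assume "S \<in> F"
    then obtain A B where AB: "(A, B) \<in> small_pairs {..<n}" "S = {..<n} - witnesses G A B"
      by (auto simp: F_def)
    have W: "witnesses G A B \<subseteq> {..<n}" by (auto simp: witnesses_def G)
    then have "card (witnesses G A B) \<le> n" using card_mono[OF _ W] by simp
    moreover have "card S = n - card (witnesses G A B)"
      using W by (simp add: AB card_Diff_subset finite_subset)
    ultimately show "S \<subseteq> verts G \<and> real (card S) \<le> (1 - 1/64) * real n"
      using many[OF AB(1)] n by (auto simp: AB G of_nat_diff)
  qed
  show "\<forall>W\<subseteq>verts G. perfect (induced_subgraph G W) \<longrightarrow> (\<exists>S\<in>F. W \<subseteq> S)"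
  proof (intro allI impI)
    fix W assume W: "W \<subseteq> verts G" "perfect (induced_subgraph G W)"
    have "{v} \<notin> edges G" for v using G(2) by (auto simp: all_edges_def)
    from perfect_misses_witnesses[OF this W(2)] obtain A B where
      AB: "A \<subseteq> W" "B \<subseteq> W" "A \<inter> B = {}" "card A \<le> 2" "card B \<le> 2"
        "W \<inter> witnesses G A B = {}" by blast
    then have "(A, B) \<in> small_pairs {..<n}" using W(1) G(1) by (auto simp: small_pairs_def)
    then have "{..<n} - witnesses G A B \<in> F" by (force simp: F_def)
    moreover have "W \<subseteq> {..<n} - witnesses G A B" using AB(6) W(1) G(1) by auto
    ultimately show "\<exists>S\<in>F. W \<subseteq> S" by blast
  qed
qed

lemma prob_some_few_witnesses:
  "measure_pmf.prob (random_graph n (1/2))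
     (\<Union>(A, B)\<in>small_pairs {..<n}. {G. real (card (witnesses G A B)) \<le> (real n - 4) / 2 ^ 5})
   \<le> (real n ^ 2 + 1) ^ 2 * exp (- (real n - 4) / 2 ^ 9)"
proof -
  let ?bad = "\<lambda>(A, B). {G. real (card (witnesses G A B)) \<le> (real n - 4) / 2 ^ 5}"
  have "measure_pmf.prob (random_graph n (1/2)) (\<Union>p\<in>small_pairs {..<n}. ?bad p)
    \<le> (\<Sum>p\<in>small_pairs {..<n}. measure_pmf.prob (random_graph n (1/2)) (?bad p))"
    by (intro measure_pmf.finite_measure_subadditive_finite card_small_pairs) auto
  also have "\<dots> \<le> (\<Sum>p\<in>small_pairs {..<n}. exp (- (real n - 4) / 2 ^ 9))"
  proof (intro sum_mono)
    fix p assume "p \<in> small_pairs {..<n}"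
    then show "measure_pmf.prob (random_graph n (1/2)) (?bad p) \<le> exp (- (real n - 4) / 2 ^ 9)"
      using prob_few_witnesses[of "fst p" n "snd p" 4] by (auto simp: small_pairs_def)
  qed
  also have "\<dots> = real (card (small_pairs {..<n})) * exp (- (real n - 4) / 2 ^ 9)"
    by simp
  also have "\<dots> \<le> (real n ^ 2 + 1) ^ 2 * exp (- (real n - 4) / 2 ^ 9)"
  proof (intro mult_right_mono)
    have "real (card (small_pairs {..<n})) \<le> real ((n ^ 2 + 1) ^ 2)"
      using card_small_pairs(2)[of "{..<n}"] by (simp only: of_nat_le_iff) simp
    then show "real (card (small_pairs {..<n})) \<le> (real n ^ 2 + 1) ^ 2" by (simp add: add.commute)
  qed simp
  finally show ?thesis by (simp add: case_prod_unfold)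
qed

theorem corollary7p4:
  shows "\<exists>(\<eta>::real) (q::nat). \<eta> > 0 \<and>
    (\<lambda>n. measure_pmf.prob (random_graph n (1/2))
       {G. \<exists>F :: nat set set.
             finite F \<and> card F \<le> n ^ q \<and>
             (\<forall>S\<in>F. S \<subseteq> verts G \<and> real (card S) \<le> (1 - \<eta>) * real n) \<and>
             (\<forall>W\<subseteq>verts G. perfect (induced_subgraph G W) \<longrightarrow> (\<exists>S\<in>F. W \<subseteq> S))})
    \<longlonglongrightarrow> 1"
proof (intro exI conjI)
  let ?P = "\<lambda>n. measure_pmf.prob (random_graph n (1/2))"
  let ?good = "\<lambda>n. {G. \<exists>F :: nat set set.
             finite F \<and> card F \<le> n ^ 6 \<and>
             (\<forall>S\<in>F. S \<subseteq> verts G \<and> real (card S) \<le> (1 - 1/64) * real n) \<and>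
             (\<forall>W\<subseteq>verts G. perfect (induced_subgraph G W) \<longrightarrow> (\<exists>S\<in>F. W \<subseteq> S))}"
  let ?bad = "\<lambda>n. \<Union>(A, B)\<in>small_pairs {..<n}.
     {G. real (card (witnesses G A B)) \<le> (real n - 4) / 2 ^ 5}"
  let ?err = "\<lambda>n. (real n ^ 2 + 1) ^ 2 * exp (- (real n - 4) / 2 ^ 9)"
  show "(1/64 :: real) > 0" by simp
  have lower: "1 - ?err n \<le> ?P n (?good n)" if n: "n \<ge> 8" for n
  proof -
    have "1 - ?err n \<le> 1 - ?P n (?bad n)"
      using prob_some_few_witnesses[of n] by simp
    also have "\<dots> = ?P n (- ?bad n)"
      using measure_pmf.prob_compl[of "?bad n" "random_graph n (1/2)"] by (simp add: Compl_eq_Diff_UNIV)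
    also have "\<dots> \<le> ?P n (?good n)"
    proof (rule measure_pmf.finite_measure_mono_AE)
      show "AE G in random_graph n (1/2). G \<in> - ?bad n \<longrightarrow> G \<in> ?good n"
      proof (intro AE_pmfI impI CollectI)
        fix G assume G: "G \<in> set_pmf (random_graph n (1/2))" and not_bad: "G \<in> - ?bad n"
        show "\<exists>F :: nat set set.
             finite F \<and> card F \<le> n ^ 6 \<and>
             (\<forall>S\<in>F. S \<subseteq> verts G \<and> real (card S) \<le> (1 - 1/64) * real n) \<and>
             (\<forall>W\<subseteq>verts G. perfect (induced_subgraph G W) \<longrightarrow> (\<exists>S\<in>F. W \<subseteq> S))"
          by (rule small_container_family)
            (use G not_bad n in \<open>auto simp: random_graph_def not_le\<close>)
      qed
    qed simp
    finally show ?thesis .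
  qed
  show "(\<lambda>n. ?P n (?good n)) \<longlonglongrightarrow> 1"
  proof (rule tendsto_sandwich[where f = "\<lambda>n. 1 - ?err n" and h = "\<lambda>_. 1"])
    show "\<forall>\<^sub>F n in sequentially. 1 - ?err n \<le> ?P n (?good n)"
      using lower unfolding eventually_sequentially by blast
    show "\<forall>\<^sub>F n in sequentially. ?P n (?good n) \<le> 1"
      by (intro always_eventually allI measure_pmf.prob_le_1)
    show "(\<lambda>n. 1 - ?err n) \<longlonglongrightarrow> 1" by real_asymp
  qed (rule tendsto_const)
qed

end
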